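(* Let $W$, $X$, $Y$ and $Z$ have degrees $1$, $2$, $3$ and $4$ respectively. The oriented Poincaré ring $\mathcal{P}_*$ is isomorphic, as a graded ring, to the quotient of the polynomial ring $\mathbb{Z}[W,X,Y,Z]$ by the homogeneous ideal generated by $$WX-2Y,\quad X^2-4Z,\quad XY-2WZ,\quad Y^2-W^2Z .$$
   Context: The oriented Poincaré ring is the graded subring $\mathcal{P}_*=\bigoplus_{n\ge 0}\mathcal{P}_n\subset\mathbb{Z}[t,z]$, graded by $\deg t=0$, $\deg z=1$, where $\mathcal{P}_n$ is the $\mathbb{Z}$-module of all polynomials $(b_0+b_1t+\dots+b_nt^n)z^n\in\mathbb{Z}[t,z]$ satisfying $b_i=b_{n-i}$ for all $i$, and $b_{n/2}\equiv 0\pmod 2$ if $n\equiv 2\pmod 4$. (These are the $\mathbb{Z}$-linear combinations of augmented Poincaré polynomials $\big(\sum_i b_i(M)t^i\big)z^n$ of closed oriented $n$-manifolds.) *)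

theory Defs
  imports
    "HOL-Algebra.Algebraic_Closure_Type"
    "HOL-Library.Poly_Mapping"
begin

locale graded_ring = ring R for R (structure) +
  fixes A :: "nat \<Rightarrow> 'a set"
  assumes part_subgroup: "additive_subgroup (A n) R"
    and part_one: "\<one> \<in> A 0"
    and part_mult: "\<lbrakk>a \<in> A m; b \<in> A n\<rbrakk> \<Longrightarrow> a \<otimes> b \<in> A (m + n)"
    and part_decomp: "x \<in> carrier R \<Longrightarrow>
      \<exists>!f. (\<forall>n. f n \<in> A n) \<and> finite {n. f n \<noteq> \<zero>} \<and> x = (\<Oplus>n\<in>{n. f n \<noteq> \<zero>}. f n)"

definition graded_ring_isomorphic ::
    "('a, 'm) ring_scheme \<Rightarrow> (nat \<Rightarrow> 'a set) \<Rightarrow> ('b, 'n) ring_scheme \<Rightarrow> (nat \<Rightarrow> 'b set) \<Rightarrow> bool"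
  where "graded_ring_isomorphic R A S B \<longleftrightarrow>
    graded_ring R A \<and> graded_ring S B \<and> (\<exists>\<phi> \<in> ring_iso R S. \<forall>n. \<phi> ` A n = B n)"

text \<open>The family induced on \<open>R Quot I\<close>; it is a grading whenever \<open>I\<close> is homogeneous.\<close>

definition quotient_part ::
    "('a, 'm) ring_scheme \<Rightarrow> (nat \<Rightarrow> 'a set) \<Rightarrow> 'a set \<Rightarrow> nat \<Rightarrow> 'a set set"
  where "quotient_part R A I n = (\<lambda>a. I +>\<^bsub>R\<^esub> a) ` A n"

text \<open>
  The ring \<open>\<int>[t,z]\<close> is represented by \<open>int poly poly\<close>, with inner indeterminate \<open>t\<close> and outer
  indeterminate \<open>z\<close>; thus \<open>Polynomial.monom b n\<close> is \<open>b(t) z^n\<close>.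
\<close>

definition oriented_poincare_part :: "nat \<Rightarrow> int poly poly set"
  where "oriented_poincare_part n =
    {Polynomial.monom b n | b :: int poly.
       Polynomial.degree b \<le> n \<and>
       (\<forall>i\<le>n. Polynomial.coeff b i = Polynomial.coeff b (n - i)) \<and>
       (n mod 4 = 2 \<longrightarrow> even (Polynomial.coeff b (n div 2)))}"

definition oriented_poincare_ring :: "int poly poly ring"
  where "oriented_poincare_ring = ring_of_type_algebra
    \<lparr>carrier := {\<Sum>n\<le>N. f n | N f. \<forall>n. f n \<in> oriented_poincare_part n}\<rparr>"

datatype indet = IW | IX | IY | IZ

primrec indet_deg :: "indet \<Rightarrow> nat"
  where "indet_deg IW = 1" | "indet_deg IX = 2" | "indet_deg IY = 3" | "indet_deg IZ = 4"

text \<open>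
  The elements of \<open>\<int>[W,X,Y,Z]\<close> are the finitely supported functions from monomials to \<open>\<int>\<close>,
  a monomial being given by its exponents; the product is convolution.
\<close>

type_synonym polyWXYZ = "(indet \<Rightarrow>\<^sub>0 nat) \<Rightarrow>\<^sub>0 int"

definition Var :: "indet \<Rightarrow> polyWXYZ"
  where "Var v = Poly_Mapping.single (Poly_Mapping.single v 1) 1"

definition monomial_deg :: "(indet \<Rightarrow>\<^sub>0 nat) \<Rightarrow> nat"
  where "monomial_deg m = (\<Sum>v\<in>Poly_Mapping.keys m. Poly_Mapping.lookup m v * indet_deg v)"

abbreviation ring_WXYZ :: "polyWXYZ ring"
  where "ring_WXYZ \<equiv> ring_of_type_algebra"

definition part_WXYZ :: "nat \<Rightarrow> polyWXYZ set"
  where "part_WXYZ n = {p. \<forall>m\<in>Poly_Mapping.keys p. monomial_deg m = n}"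

definition ideal_WXYZ :: "polyWXYZ set"
  where "ideal_WXYZ = Idl\<^bsub>ring_WXYZ\<^esub>
    {Var IW * Var IX - 2 * Var IY,
     Var IX ^ 2 - 4 * Var IZ,
     Var IX * Var IY - 2 * Var IW * Var IZ,
     Var IY ^ 2 - Var IW ^ 2 * Var IZ}"

end

theory Submission
  imports Defs
begin

text \<open>
  The isomorphism is induced by evaluating polynomials in \<open>W, X, Y, Z\<close> at the four elements
  \<open>W = (1 + t) z\<close>, \<open>X = 2 t z^2\<close>, \<open>Y = t (1 + t) z^3\<close> and \<open>Z = t^2 z^4\<close> of \<open>\<int>[t,z]\<close>,
  which satisfy the four relations.  Both surjectivity and the determination of the kernel come
  from matching a basis of the degree \<open>n\<close> part \<open>P\<^sub>n\<close> of the Poincare ring with a set of standard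
  monomials.

  The polynomials \<open>t^j (1 + t)^(n - 2 j)\<close> with \<open>2 j \<le> n\<close> are symmetric, and their lowest terms
  \<open>t^j\<close> have coefficient 1, so they form a \<open>\<int>\<close>-basis of the polynomials of degree at most \<open>n\<close> with
  \<open>b\<^sub>i = b\<^sub>n\<^sub>-\<^sub>i\<close>.  For even \<open>n\<close> their middle coefficients are central binomial coefficients,
  which are even except for \<open>t^j\<close> itself, when \<open>n = 2 j\<close>.  The parity condition for \<open>n \<equiv> 2\<close>
  modulo 4 thus amounts to doubling \<open>t^j\<close> when \<open>n = 2 j\<close> with \<open>j\<close> odd (\<open>basis_poly_spans\<close>,
  \<open>basis_poly_independent\<close>).

  These basis elements are the values of the monomials \<open>W^a Z^k\<close>, \<open>X Z^k\<close> and
  \<open>W^a Y Z^k\<close>, with \<open>j = 2 k\<close> for the first kind and \<open>j = 2 k + 1\<close> for the others; exactly one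
  of them belongs to each pair \<open>(n, j)\<close>.  The relations are precisely what is needed to rewrite
  the product of a variable with a standard monomial as an integer multiple of a standard monomial
  (\<open>Var_times_standard_monomial\<close>), so modulo the ideal every homogeneous polynomial of degree \<open>n\<close>
  is an integer combination of the standard monomials of degree \<open>n\<close>
  (\<open>homogeneous_reduces_to_standard\<close>).  Hence evaluation maps the degree \<open>n\<close> part onto \<open>P\<^sub>n\<close>
  (\<open>evaluate_part_WXYZ\<close>), and a homogeneous polynomial evaluating to zero reduces to the trivial
  combination, that is, lies in the ideal (\<open>homogeneous_kernel\<close>).  Since different degrees
  evaluate to multiples of different powers of \<open>z\<close>, this gives the whole kernel.

  That the \<open>P\<^sub>n\<close> are closed under multiplication also follows from this description of \<open>P\<^sub>n\<close> as an
  image.  The grading of the quotient is obtained by transport along the isomorphism.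
\<close>

section \<open>Evaluating integer polynomials in commuting indeterminates\<close>

definition monomial_value :: "('v \<Rightarrow> 'a::comm_ring_1) \<Rightarrow> ('v \<Rightarrow>\<^sub>0 nat) \<Rightarrow> 'a"
  where "monomial_value g m = (\<Prod>v\<in>Poly_Mapping.keys m. g v ^ Poly_Mapping.lookup m v)"

definition evaluate :: "('v \<Rightarrow> 'a::comm_ring_1) \<Rightarrow> (('v \<Rightarrow>\<^sub>0 nat) \<Rightarrow>\<^sub>0 int) \<Rightarrow> 'a"
  where "evaluate g p =
    (\<Sum>m\<in>Poly_Mapping.keys p. of_int (Poly_Mapping.lookup p m) * monomial_value g m)"

lemma monomial_value_superset:
  assumes "finite S" "Poly_Mapping.keys m \<subseteq> S"
  shows "monomial_value g m = (\<Prod>v\<in>S. g v ^ Poly_Mapping.lookup m v)"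
  unfolding monomial_value_def using assms
  by (intro prod.mono_neutral_left) (auto simp: in_keys_iff)

lemma monomial_value_add:
  "monomial_value g (m + m') = monomial_value g m * monomial_value g m'"
proof -
  let ?S = "Poly_Mapping.keys m \<union> Poly_Mapping.keys m'"
  have "monomial_value g (m + m') = (\<Prod>v\<in>?S. g v ^ Poly_Mapping.lookup (m + m') v)"
    using Poly_Mapping.keys_add[of m m'] by (intro monomial_value_superset) auto
  also have "\<dots> = monomial_value g m * monomial_value g m'"
    using monomial_value_superset[of ?S m g] monomial_value_superset[of ?S m' g]
    by (simp add: lookup_add power_add prod.distrib)
  finally show ?thesis .
qed

lemma evaluate_single:
  "evaluate g (Poly_Mapping.single m c) = of_int c * monomial_value g m"
  by (simp add: evaluate_def)

lemma evaluate_add: "evaluate g (p + q) = evaluate g p + evaluate g q"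
  unfolding evaluate_def
  by (rule setsum_keys_plus_distrib) (simp_all add: distrib_right)

lemma evaluate_zero [simp]: "evaluate g 0 = 0"
  by (simp add: evaluate_def)

lemma evaluate_diff: "evaluate g (p - q) = evaluate g p - evaluate g q"
  using evaluate_add[of g "p - q" q] by simp

lemma evaluate_sum: "evaluate g (\<Sum>i\<in>A. p i) = (\<Sum>i\<in>A. evaluate g (p i))"
  by (induction A rule: infinite_finite_induct) (simp_all add: evaluate_add)

text \<open>
  Both sides are additive in each factor, so it suffices to compare them on products of two
  monomials, to which \<open>frag_induction\<close> reduces the claim in two rounds.
\<close>

lemma evaluate_mult: "evaluate g (p * q) = evaluate g p * evaluate g q"
proof -
  have monomials: "evaluate g (frag_of m * frag_of m') = evaluate g (frag_of m) * evaluate g (frag_of m')"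
    for m m'
    by (simp add: mult_single evaluate_single monomial_value_add)
  have "evaluate g (frag_of m * q) = evaluate g (frag_of m) * evaluate g q" for m
    using subset_UNIV[of "Poly_Mapping.keys q"]
    by (induction q rule: frag_induction)
      (simp_all add: monomials evaluate_diff right_diff_distrib)
  with subset_UNIV[of "Poly_Mapping.keys p"] show ?thesis
    by (induction p rule: frag_induction)
      (simp_all add: evaluate_diff left_diff_distrib)
qed

lemma evaluate_of_int: "evaluate g (of_int c) = of_int c"
  by (subst single_of_int [symmetric]) (simp add: evaluate_single monomial_value_def)

lemma evaluate_one: "evaluate g 1 = 1"
  using evaluate_of_int[of g 1] by simp

lemma evaluate_numeral: "evaluate g (numeral k) = numeral k"
  using evaluate_of_int[of g "numeral k"] by simp

lemma evaluate_power: "evaluate g (p ^ k) = evaluate g p ^ k"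
  by (induction k) (simp_all add: evaluate_one evaluate_mult)

lemma evaluate_Var: "evaluate g (Var v) = g v"
  by (simp add: Var_def evaluate_single monomial_value_def)

section \<open>A basis of the symmetric polynomials of each degree\<close>

text \<open>
  The condition that membership of \<open>b z^n\<close> in \<open>oriented_poincare_part n\<close> puts on \<open>b\<close>; working in
  \<open>\<int>[t]\<close> avoids carrying the factor \<open>z^n\<close> along.
\<close>

definition symmetric_coeffs :: "nat \<Rightarrow> int poly \<Rightarrow> bool"
  where "symmetric_coeffs n b \<longleftrightarrow> Polynomial.degree b \<le> n \<and>
    (\<forall>i\<le>n. Polynomial.coeff b i = Polynomial.coeff b (n - i)) \<and>
    (n mod 4 = 2 \<longrightarrow> even (Polynomial.coeff b (n div 2)))"

lemma oriented_poincare_part_eq: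
  "oriented_poincare_part n = (\<lambda>b. Polynomial.monom b n) ` Collect (symmetric_coeffs n)"
  unfolding oriented_poincare_part_def symmetric_coeffs_def by blast

text \<open>
  The middle power \<open>t^j\<close> in degree \<open>n = 2 j\<close> violates the parity condition exactly for odd \<open>j\<close>, and
  has to be doubled there.
\<close>

definition basis_scale :: "nat \<Rightarrow> nat \<Rightarrow> int"
  where "basis_scale n j = (if odd j \<and> n = 2 * j then 2 else 1)"

definition basis_poly :: "nat \<Rightarrow> nat \<Rightarrow> int poly"
  where "basis_poly n j =
    Polynomial.smult (basis_scale n j) (Polynomial.monom 1 j * [:1, 1:] ^ (n - 2 * j))"

lemma basis_scale_nonzero [simp]: "basis_scale n j \<noteq> 0"
  by (simp add: basis_scale_def)

lemma coeff_basis_poly: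
  "Polynomial.coeff (basis_poly n j) i =
    (if i < j then 0 else basis_scale n j * int ((n - 2 * j) choose (i - j)))"
proof -
  have "Polynomial.coeff ([:1, 1:] ^ a) k = int (a choose k)" for a k
    by (cases "k \<le> a")
      (simp_all add: coeff_linear_poly_power coeff_eq_0 degree_linear_power)
  then show ?thesis
    by (simp add: basis_poly_def coeff_monom_mult)
qed

lemma even_central_binomial: "k > 0 \<Longrightarrow> even ((2 * k) choose k)"
proof -
  assume "k > 0"
  then obtain l where k: "k = Suc l" by (cases k) auto
  have "Suc (2 * l) choose Suc l = Suc (2 * l) choose l"
    using binomial_symmetric[of "Suc l" "Suc (2 * l)"] by simp
  then have "(2 * k) choose k = 2 * (Suc (2 * l) choose l)"
    by (simp add: k)
  then show ?thesis by simp
qed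

text \<open>
  Symmetry is that of the binomial coefficients.  The middle coefficient is a central binomial
  coefficient, hence even, unless \<open>n = 2 j\<close>, where the scale provides the factor 2.
\<close>

lemma basis_poly_symmetric:
  assumes "2 * j \<le> n"
  shows "symmetric_coeffs n (basis_poly n j)"
  unfolding symmetric_coeffs_def
proof (intro conjI allI impI)
  show "Polynomial.degree (basis_poly n j) \<le> n"
    using assms by (intro degree_le) (auto simp: coeff_basis_poly)
next
  fix i assume "i \<le> n"
  consider "i < j" | "n - i < j" | "j \<le> i" "j \<le> n - i" by linarith
  then show "Polynomial.coeff (basis_poly n j) i = Polynomial.coeff (basis_poly n j) (n - i)"
  proof cases
    case 3
    then have "n - 2 * j - (i - j) = n - i - j" "i - j \<le> n - 2 * j"
      using assms \<open>i \<le> n\<close> by linarith+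
    then show ?thesis
      using 3 binomial_symmetric[of "i - j" "n - 2 * j"] by (simp add: coeff_basis_poly)
  qed (use assms \<open>i \<le> n\<close> in \<open>auto simp: coeff_basis_poly\<close>)
next
  assume n: "n mod 4 = 2"
  define h where "h = n div 2"
  have h: "n = 2 * h" "odd h"
    using n unfolding h_def by presburger+
  show "even (Polynomial.coeff (basis_poly n j) (n div 2))"
  proof (cases "h = j")
    case True
    then show ?thesis using h by (simp add: coeff_basis_poly basis_scale_def)
  next
    case False
    then have "even ((2 * (h - j)) choose (h - j))"
      using assms h by (intro even_central_binomial) simp
    then show ?thesis
      using assms h by (simp add: coeff_basis_poly diff_mult_distrib2)
  qed
qed

lemma symmetric_coeffs_zero: "symmetric_coeffs n 0"
  by (simp add: symmetric_coeffs_def)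

lemma symmetric_coeffsD:
  assumes "symmetric_coeffs n b"
  shows "Polynomial.degree b \<le> n"
    and "i \<le> n \<Longrightarrow> Polynomial.coeff b i = Polynomial.coeff b (n - i)"
    and "n mod 4 = 2 \<Longrightarrow> even (Polynomial.coeff b (n div 2))"
  using assms unfolding symmetric_coeffs_def by blast+

lemma symmetric_coeffs_add:
  "symmetric_coeffs n a \<Longrightarrow> symmetric_coeffs n b \<Longrightarrow> symmetric_coeffs n (a + b)"
  unfolding symmetric_coeffs_def by (metis coeff_add degree_add_le dvd_add)

lemma symmetric_coeffs_smult:
  "symmetric_coeffs n a \<Longrightarrow> symmetric_coeffs n (Polynomial.smult c a)"
  unfolding symmetric_coeffs_def by (metis coeff_smult degree_smult_le dvd_mult order_trans)

lemma symmetric_coeffs_diff: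
  "symmetric_coeffs n a \<Longrightarrow> symmetric_coeffs n b \<Longrightarrow> symmetric_coeffs n (a - b)"
  using symmetric_coeffs_add[of n a "Polynomial.smult (-1) b"] symmetric_coeffs_smult[of n b "-1"]
  by simp

lemma symmetric_coeffs_sum:
  "(\<And>i. i \<in> A \<Longrightarrow> symmetric_coeffs n (b i)) \<Longrightarrow> symmetric_coeffs n (\<Sum>i\<in>A. b i)"
  by (induction A rule: infinite_finite_induct)
    (simp_all add: symmetric_coeffs_zero symmetric_coeffs_add)

lemma symmetric_coeffs_eq_zero:
  assumes "symmetric_coeffs n b" and "\<And>i. i \<le> n div 2 \<Longrightarrow> Polynomial.coeff b i = 0"
  shows "b = 0"
proof (rule poly_eqI)
  fix i
  consider "i > n" | "i \<le> n div 2" | "i \<le> n" "n - i \<le> n div 2" by linarith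
  then show "Polynomial.coeff b i = Polynomial.coeff 0 i"
  proof cases
    case 1
    then show ?thesis using symmetric_coeffsD(1)[OF assms(1)] by (simp add: coeff_eq_0)
  next
    case 3
    then have "Polynomial.coeff b i = Polynomial.coeff b (n - i)"
      using symmetric_coeffsD(2)[OF assms(1)] by blast
    with 3 show ?thesis using assms(2) by simp
  qed (simp add: assms(2))
qed

text \<open>
  Since \<open>basis_poly n k\<close> starts at \<open>t^k\<close>, the coefficients of \<open>b\<close> can be eliminated from the lowest
  one upwards.  Once those up to the middle are gone, symmetry kills the rest.
\<close>

lemma basis_poly_spans:
  assumes "symmetric_coeffs n b"
  shows "\<exists>c. b = (\<Sum>j\<le>n div 2. Polynomial.smult (c j) (basis_poly n j))"
proof -
  let ?r = "\<lambda>c k. b - (\<Sum>j<k. Polynomial.smult (c j) (basis_poly n j))"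
  have "\<exists>c. \<forall>i<k. Polynomial.coeff (?r c k) i = 0" if "k \<le> Suc (n div 2)" for k
    using that
  proof (induction k)
    case 0
    show ?case by simp
  next
    case (Suc k)
    then obtain c where c: "\<And>i. i < k \<Longrightarrow> Polynomial.coeff (?r c k) i = 0" by auto
    have "symmetric_coeffs n (?r c k)"
      using Suc.prems assms
      by (intro symmetric_coeffs_diff symmetric_coeffs_sum symmetric_coeffs_smult
          basis_poly_symmetric) auto
    \<comment> \<open>A scale of 2 occurs only at the middle coefficient in degrees 2 modulo 4, where the
      parity condition makes the coefficient to be eliminated even.\<close>
    then have "even (Polynomial.coeff (?r c k) (n div 2))" if "n mod 4 = 2"
      using that by (rule symmetric_coeffsD(3))
    moreover have "n mod 4 = 2 \<and> n div 2 = k" if "odd k" "n = 2 * k"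
      using that by presburger
    ultimately have "basis_scale n k dvd Polynomial.coeff (?r c k) k"
      unfolding basis_scale_def by auto
    then obtain d where d: "Polynomial.coeff (?r c k) k = basis_scale n k * d" by blast
    have "?r (c(k := d)) (Suc k) = ?r c k - Polynomial.smult d (basis_poly n k)"
      by simp
    moreover have "Polynomial.coeff (?r c k - Polynomial.smult d (basis_poly n k)) i = 0"
      if "i < Suc k" for i
      using that c[of i] d
      by (cases "i = k") (simp_all only: coeff_diff coeff_smult coeff_basis_poly, auto)
    ultimately show ?case by metis
  qed
  from this[of "Suc (n div 2)"] obtain c
    where "\<And>i. i \<le> n div 2 \<Longrightarrow> Polynomial.coeff (?r c (Suc (n div 2))) i = 0"
    by (auto simp: less_Suc_eq_le)
  moreover have "symmetric_coeffs n (?r c (Suc (n div 2)))"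
    using assms
    by (intro symmetric_coeffs_diff symmetric_coeffs_sum symmetric_coeffs_smult
        basis_poly_symmetric) auto
  ultimately have "?r c (Suc (n div 2)) = 0" by (intro symmetric_coeffs_eq_zero)
  then show ?thesis by (auto simp: lessThan_Suc_atMost)
qed

lemma basis_poly_independent:
  assumes "(\<Sum>j\<le>n div 2. Polynomial.smult (c j) (basis_poly n j)) = 0" and "j \<le> n div 2"
  shows "c j = 0"
  using assms(2)
proof (induction j rule: less_induct)
  case (less j)
  have "0 = Polynomial.coeff (\<Sum>k\<le>n div 2. Polynomial.smult (c k) (basis_poly n k)) j"
    by (simp add: assms(1))
  also have "\<dots> = (\<Sum>k\<le>n div 2. c k * Polynomial.coeff (basis_poly n k) j)"
    by (simp add: coeff_sum)
  also have "\<dots> = (\<Sum>k\<le>n div 2. if k = j then c j * basis_scale n j else 0)"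
  proof (rule sum.cong[OF refl])
    fix k assume k: "k \<in> {..n div 2}"
    consider "k < j" | "k = j" | "k > j" by linarith
    then show "c k * Polynomial.coeff (basis_poly n k) j = (if k = j then c j * basis_scale n j else 0)"
    proof cases
      case 1
      then show ?thesis using less k by simp
    qed (simp_all add: coeff_basis_poly)
  qed
  also have "\<dots> = c j * basis_scale n j" using less.prems by simp
  finally show ?case by simp
qed

section \<open>Standard monomials modulo the relations\<close>

definition poincare_gen :: "indet \<Rightarrow> int poly poly"
  where "poincare_gen v = (case v of
      IW \<Rightarrow> Polynomial.monom [:1, 1:] 1
    | IX \<Rightarrow> Polynomial.monom [:0, 2:] 2
    | IY \<Rightarrow> Polynomial.monom [:0, 1, 1:] 3
    | IZ \<Rightarrow> Polynomial.monom [:0, 0, 1:] 4)"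

text \<open>
  The indexing is chosen so that \<open>standard_monomial n j\<close> has degree \<open>n\<close> and evaluates to
  \<open>basis_poly n j\<close>: the factors \<open>Z\<close>, \<open>X\<close> and \<open>Y\<close> contribute 2, 1 and 1 to the exponent \<open>j\<close>.
\<close>

definition standard_monomial :: "nat \<Rightarrow> nat \<Rightarrow> polyWXYZ"
  where "standard_monomial n j =
    (if even j then Var IW ^ (n - 2 * j) * Var IZ ^ (j div 2)
     else if n = 2 * j then Var IX * Var IZ ^ (j div 2)
     else Var IW ^ (n - 2 * j - 1) * Var IY * Var IZ ^ (j div 2))"

lemma standard_monomial_simps:
  "standard_monomial (4 * k + a) (2 * k) = Var IW ^ a * Var IZ ^ k"
  "standard_monomial (4 * k + 2) (2 * k + 1) = Var IX * Var IZ ^ k"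
  "standard_monomial (4 * k + 3 + a) (2 * k + 1) = Var IW ^ a * Var IY * Var IZ ^ k"
  by (auto simp: standard_monomial_def)

lemma standard_index_cases:
  fixes n j :: nat
  assumes "2 * j \<le> n"
  obtains (W) a k where "n = 4 * k + a" "j = 2 * k"
    | (X) k where "n = 4 * k + 2" "j = 2 * k + 1"
    | (Y) a k where "n = 4 * k + 3 + a" "j = 2 * k + 1"
proof (cases "even j")
  case True
  then obtain k where "j = 2 * k" by blast
  with assms show ?thesis using W[of k "n - 4 * k"] by simp
next
  case False
  then obtain k where "j = 2 * k + 1" by (elim oddE)
  with assms show ?thesis
    using X[of k] Y[of k "n - (4 * k + 3)"] by (cases "n = 4 * k + 2") auto
qed

lemma evaluate_standard_monomial:
  assumes "2 * j \<le> n"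
  shows "evaluate poincare_gen (standard_monomial n j) = Polynomial.monom (basis_poly n j) n"
proof -
  note eval = evaluate_mult evaluate_power evaluate_Var poincare_gen_def
  have Z: "[:0, 0, 1:] = [:0, 1 :: int:] ^ 2"
    by (simp add: power2_eq_square)
  have X: "[:0, 2:] = 2 * [:0, 1 :: int:]"
    by (simp add: numeral_poly)
  have sm: "Polynomial.smult 2 p = 2 * p" for p :: "int poly"
    by (simp add: numeral_poly)
  have t: "Polynomial.monom 1 i = [:0, 1 :: int:] ^ i" for i
    by (simp add: monom_altdef)
  from assms show ?thesis
  proof (cases rule: standard_index_cases)
    case (W a k)
    then show ?thesis
      unfolding W standard_monomial_simps eval basis_poly_def t
      by (simp add: Z monom_power mult_monom basis_scale_def mult.commute add.commute flip: power_mult)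
  next
    case (X k)
    then show ?thesis
      unfolding X standard_monomial_simps eval basis_poly_def t
      by (simp add: X Z monom_power mult_monom basis_scale_def sm flip: power_mult)
  next
    case (Y a k)
    have "4 * k + 3 + a - 2 * (2 * k + 1) = Suc a" by simp
    with Y show ?thesis
      unfolding Y standard_monomial_simps eval basis_poly_def t
      by (simp add: Z monom_power mult_monom basis_scale_def flip: power_mult)
        (simp add: mult.commute add_ac)
  qed
qed

lemma ring_of_type_algebra_simps [simp]:
  "carrier (ring_of_type_algebra :: 'a::ring_1 ring) = UNIV"
  "x \<otimes>\<^bsub>ring_of_type_algebra\<^esub> y = x * y"
  "x \<oplus>\<^bsub>ring_of_type_algebra\<^esub> y = x + y"
  "\<one>\<^bsub>ring_of_type_algebra\<^esub> = 1"
  "\<zero>\<^bsub>ring_of_type_algebra\<^esub> = 0"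
  by (simp_all add: ring_of_type_algebra_def)

interpretation WXYZ: cring ring_WXYZ
  by (rule cring_from_type_algebra)

lemma ideal_WXYZ_ideal: "ideal ideal_WXYZ ring_WXYZ"
  unfolding ideal_WXYZ_def by (rule WXYZ.genideal_ideal) simp

definition cong_WXYZ :: "polyWXYZ \<Rightarrow> polyWXYZ \<Rightarrow> bool" (infix \<open>\<simeq>\<^sub>I\<close> 50)
  where "p \<simeq>\<^sub>I q \<longleftrightarrow> p - q \<in> ideal_WXYZ"

lemma ideal_WXYZ_zero: "0 \<in> ideal_WXYZ"
  using additive_subgroup.zero_closed[OF ideal.axioms(1)[OF ideal_WXYZ_ideal]] by simp

lemma ideal_WXYZ_add: "p \<in> ideal_WXYZ \<Longrightarrow> q \<in> ideal_WXYZ \<Longrightarrow> p + q \<in> ideal_WXYZ"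
  using additive_subgroup.a_closed[OF ideal.axioms(1)[OF ideal_WXYZ_ideal], of p q] by simp

lemma ideal_WXYZ_mult: "p \<in> ideal_WXYZ \<Longrightarrow> r * p \<in> ideal_WXYZ"
  using ideal.I_l_closed[OF ideal_WXYZ_ideal, of p r] by simp

lemma ideal_WXYZ_sum: "(\<And>i. i \<in> A \<Longrightarrow> p i \<in> ideal_WXYZ) \<Longrightarrow> (\<Sum>i\<in>A. p i) \<in> ideal_WXYZ"
  by (induction A rule: infinite_finite_induct) (simp_all add: ideal_WXYZ_zero ideal_WXYZ_add)

lemma cong_WXYZ_refl: "p \<simeq>\<^sub>I p"
  by (simp add: cong_WXYZ_def ideal_WXYZ_zero)

lemma cong_WXYZ_trans: "p \<simeq>\<^sub>I q \<Longrightarrow> q \<simeq>\<^sub>I r \<Longrightarrow> p \<simeq>\<^sub>I r"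
  unfolding cong_WXYZ_def using ideal_WXYZ_add[of "p - q" "q - r"] by simp

lemma cong_WXYZ_mult: "p \<simeq>\<^sub>I q \<Longrightarrow> r * p \<simeq>\<^sub>I r * q"
  unfolding cong_WXYZ_def using ideal_WXYZ_mult[of "p - q" r] by (simp add: right_diff_distrib)

lemma cong_WXYZ_diff:
  assumes "p \<simeq>\<^sub>I q" "p' \<simeq>\<^sub>I q'"
  shows "p - p' \<simeq>\<^sub>I q - q'"
  using ideal_WXYZ_add[of "p - q" "(-1) * (p' - q')"] ideal_WXYZ_mult[of "p' - q'" "-1"] assms
  unfolding cong_WXYZ_def by (simp add: algebra_simps)

lemma relations_WXYZ:
  "Var IW * Var IX \<simeq>\<^sub>I 2 * Var IY"
  "Var IX * Var IX \<simeq>\<^sub>I 4 * Var IZ"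
  "Var IX * Var IY \<simeq>\<^sub>I 2 * Var IW * Var IZ"
  "Var IY * Var IY \<simeq>\<^sub>I Var IW ^ 2 * Var IZ"
  unfolding cong_WXYZ_def ideal_WXYZ_def
  by (auto intro!: subsetD[OF WXYZ.genideal_self] simp flip: power2_eq_square)

text \<open>
  The three shapes of standard monomials times the four variables.  If the product is not
  already standard, then rewriting a single factor \<open>W X\<close>, \<open>X X\<close>, \<open>X Y\<close> or \<open>Y Y\<close> in it gives a
  multiple of a standard monomial.  Where both \<open>W X\<close> and \<open>X Y\<close> occur, \<open>X Y\<close> is the one to rewrite.
\<close>

lemma Var_times_standard_monomial:
  assumes "2 * j \<le> n"
  shows "\<exists>c i. 2 * i \<le> n + indet_deg v \<and>
    Var v * standard_monomial n j \<simeq>\<^sub>I of_int c * standard_monomial (n + indet_deg v) i"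
    (is "\<exists>c i. ?P c i")
  using assms
proof (cases rule: standard_index_cases)
  case (W a k)
  note s = W standard_monomial_def
  show ?thesis
  proof (cases v)
    case IW
    have "?P 1 j"
      using cong_WXYZ_refl
      by (simp add: s IW mult.assoc)
    then show ?thesis by blast
  next
    case IX
    show ?thesis
    proof (cases a)
      case 0
      have "?P 1 (j + 1)"
        using cong_WXYZ_refl
        by (simp add: s IX 0)
      then show ?thesis by blast
    next
      case (Suc b)
      have "?P 2 (j + 1)"
        using cong_WXYZ_mult[OF relations_WXYZ(1), of "Var IW ^ b * Var IZ ^ k"]
        by (simp add: s IX Suc mult_ac add_ac)
      then show ?thesis by blast
    qed
  next
    case IY
    have "?P 1 (j + 1)"
      using cong_WXYZ_refl
      by (simp add: s IY mult_ac add_ac)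
    then show ?thesis by blast
  next
    case IZ
    have "?P 1 (j + 2)"
      using cong_WXYZ_refl
      by (simp add: s IZ mult_ac add_ac)
    then show ?thesis by blast
  qed
next
  case (X k)
  note s = X standard_monomial_def
  show ?thesis
  proof (cases v)
    case IW
    have "?P 2 j"
      using cong_WXYZ_mult[OF relations_WXYZ(1), of "Var IZ ^ k"]
      by (simp add: s IW mult_ac add_ac)
    then show ?thesis by blast
  next
    case IX
    have "?P 4 (j + 1)"
      using cong_WXYZ_mult[OF relations_WXYZ(2), of "Var IZ ^ k"]
      by (simp add: s IX mult_ac add_ac)
    then show ?thesis by blast
  next
    case IY
    have "?P 2 (j + 1)"
      using cong_WXYZ_mult[OF relations_WXYZ(3), of "Var IZ ^ k"]
      by (simp add: s IY mult_ac add_ac)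
    then show ?thesis by blast
  next
    case IZ
    have "?P 1 (j + 2)"
      using cong_WXYZ_refl
      by (simp add: s IZ mult_ac add_ac)
    then show ?thesis by blast
  qed
next
  case (Y a k)
  note s = Y standard_monomial_def
  show ?thesis
  proof (cases v)
    case IW
    have "?P 1 j"
      using cong_WXYZ_refl
      by (simp add: s IW mult_ac add_ac)
    then show ?thesis by blast
  next
    case IX
    have "?P 2 (j + 1)"
      using cong_WXYZ_mult[OF relations_WXYZ(3), of "Var IW ^ a * Var IZ ^ k"]
      by (simp add: s IX mult_ac add_ac)
    then show ?thesis by blast
  next
    case IY
    have "?P 1 (j + 1)"
      using cong_WXYZ_mult[OF relations_WXYZ(4), of "Var IW ^ a * Var IZ ^ k"]
      by (simp add: s IY mult_ac add_ac power2_eq_square)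
    then show ?thesis by blast
  next
    case IZ
    have "?P 1 (j + 2)"
      using cong_WXYZ_refl
      by (simp add: s IZ mult_ac add_ac)
    then show ?thesis by blast
  qed
qed

lemma monomial_deg_add: "monomial_deg (m + m') = monomial_deg m + monomial_deg m'"
  unfolding monomial_deg_def
  by (rule setsum_keys_plus_distrib) (simp_all add: distrib_right)

lemma monomial_deg_single: "monomial_deg (Poly_Mapping.single v e) = e * indet_deg v"
  by (simp add: monomial_deg_def)

text \<open>
  Split off one variable, reduce the remaining monomial of smaller degree, and multiply back.
\<close>

lemma monomial_reduces_to_standard:
  "\<exists>c j. 2 * j \<le> monomial_deg m \<and>
    frag_of m \<simeq>\<^sub>I of_int c * standard_monomial (monomial_deg m) j"
proof (induction "monomial_deg m" arbitrary: m rule: less_induct)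
  case less
  show ?case
  proof (cases "m = 0")
    case True
    then show ?thesis
      by (intro exI[of _ 1] exI[of _ 0])
        (simp add: monomial_deg_def standard_monomial_def cong_WXYZ_refl)
  next
    case False
    then obtain v where v: "Poly_Mapping.lookup m v \<noteq> 0"
      by (metis lookup_zero poly_mapping_eqI)
    define m' where "m' = m - Poly_Mapping.single v 1"
    have m: "m = Poly_Mapping.single v 1 + m'"
      using v by (intro poly_mapping_eqI) (auto simp: m'_def lookup_add lookup_minus lookup_single when_def)
    have deg: "monomial_deg m = monomial_deg m' + indet_deg v"
      by (simp add: m monomial_deg_add monomial_deg_single)
    moreover have "indet_deg v > 0" by (cases v) simp_all
    ultimately obtain c j where "2 * j \<le> monomial_deg m'"
      and c: "frag_of m' \<simeq>\<^sub>I of_int c * standard_monomial (monomial_deg m') j"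
      using less[of m'] by auto
    then obtain d i where i: "2 * i \<le> monomial_deg m" and
      "Var v * standard_monomial (monomial_deg m') j \<simeq>\<^sub>I
        of_int d * standard_monomial (monomial_deg m) i"
      using Var_times_standard_monomial[of j "monomial_deg m'" v] deg by auto
    then have "of_int c * (Var v * standard_monomial (monomial_deg m') j) \<simeq>\<^sub>I
        of_int (c * d) * standard_monomial (monomial_deg m) i"
      using cong_WXYZ_mult[of _ _ "of_int c"] by (simp add: mult.assoc)
    moreover have "frag_of m \<simeq>\<^sub>I of_int c * (Var v * standard_monomial (monomial_deg m') j)"
      using cong_WXYZ_mult[OF c, of "Var v"]
      by (simp add: m Var_def mult_single mult.left_commute)
    ultimately show ?thesis
      using i cong_WXYZ_trans by blast
  qed
qed

lemma homogeneous_reduces_to_standard: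
  assumes "p \<in> part_WXYZ n"
  shows "\<exists>c. p \<simeq>\<^sub>I (\<Sum>j\<le>n div 2. of_int (c j) * standard_monomial n j)"
proof -
  have "Poly_Mapping.keys p \<subseteq> {m. monomial_deg m = n}"
    using assms by (auto simp: part_WXYZ_def)
  then show ?thesis
  proof (induction p rule: frag_induction)
    case zero
    show ?case by (intro exI[of _ "\<lambda>_. 0"]) (simp add: cong_WXYZ_refl)
  next
    case (one m)
    then obtain c j where j: "2 * j \<le> n" and c: "frag_of m \<simeq>\<^sub>I of_int c * standard_monomial n j"
      using monomial_reduces_to_standard[of m] by auto
    have "(\<Sum>i\<le>n div 2. of_int (if i = j then c else 0) * standard_monomial n i)
      = (\<Sum>i\<le>n div 2. if i = j then of_int c * standard_monomial n j else 0)"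
      by (intro sum.cong) auto
    moreover have "j \<le> n div 2" using j by linarith
    ultimately show ?case using c by (intro exI[of _ "\<lambda>i. if i = j then c else 0"]) simp
  next
    case (diff p q)
    then obtain c d where
      "p \<simeq>\<^sub>I (\<Sum>j\<le>n div 2. of_int (c j) * standard_monomial n j)"
      "q \<simeq>\<^sub>I (\<Sum>j\<le>n div 2. of_int (d j) * standard_monomial n j)" by blast
    from cong_WXYZ_diff[OF this] show ?case
      by (intro exI[of _ "\<lambda>j. c j - d j"]) (simp add: left_diff_distrib sum_subtractf)
  qed
qed

section \<open>The evaluation homomorphism and its kernel\<close>

lemma of_int_times_monom:
  "of_int c * Polynomial.monom b n = Polynomial.monom (Polynomial.smult c b) n" for b :: "int poly"
  by (rule poly_eqI) (simp add: of_int_poly)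

lemma evaluate_standard_combination:
  "evaluate poincare_gen (\<Sum>j\<le>n div 2. of_int (c j) * standard_monomial n j)
    = Polynomial.monom (\<Sum>j\<le>n div 2. Polynomial.smult (c j) (basis_poly n j)) n"
proof -
  have "evaluate poincare_gen (of_int (c j) * standard_monomial n j)
    = Polynomial.monom (Polynomial.smult (c j) (basis_poly n j)) n" if "j \<le> n div 2" for j
  proof -
    have "2 * j \<le> n" using that by linarith
    then show ?thesis
      by (simp add: evaluate_mult evaluate_of_int evaluate_standard_monomial of_int_times_monom)
  qed
  then show ?thesis
    unfolding evaluate_sum monom_sum by (intro sum.cong) auto
qed

lemma evaluate_ring_hom: "ring_hom_ring ring_WXYZ ring_of_type_algebra (evaluate g)"
proof (rule ring_hom_ringI)
  show "ring ring_WXYZ" by (rule ring_from_type_algebra)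
  show "ring (ring_of_type_algebra :: 'a::comm_ring_1 ring)" by (rule ring_from_type_algebra)
qed (simp_all add: evaluate_add evaluate_mult evaluate_one)

lemma evaluate_ideal_WXYZ:
  assumes "p \<in> ideal_WXYZ"
  shows "evaluate poincare_gen p = 0"
proof -
  let ?K = "a_kernel ring_WXYZ ring_of_type_algebra (evaluate poincare_gen)"
  have K: "?K = {p. evaluate poincare_gen p = 0}"
    by (simp add: a_kernel_def')
  have numeral: "numeral k * Polynomial.monom b n = Polynomial.monom (Polynomial.smult (numeral k) b) n"
    for k n and b :: "int poly"
    using of_int_times_monom[of "numeral k" b n] by simp
  note eval = evaluate_diff evaluate_mult evaluate_power evaluate_Var evaluate_numeral
    poincare_gen_def indet.case power2_eq_square mult.assoc mult_monom numeral
  have "ideal_WXYZ \<subseteq> ?K"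
    unfolding ideal_WXYZ_def
  proof (rule WXYZ.genideal_minimal[OF ring_hom_ring.kernel_is_ideal[OF evaluate_ring_hom]], unfold K, intro subsetI CollectI)
    fix p assume "p \<in> {Var IW * Var IX - 2 * Var IY, Var IX ^ 2 - 4 * Var IZ,
      Var IX * Var IY - 2 * Var IW * Var IZ, Var IY ^ 2 - Var IW ^ 2 * Var IZ}"
    then show "evaluate poincare_gen p = 0"
      by (elim insertE emptyE; simp only: eval; simp add: eval_nat_numeral)
  qed
  with assms K show ?thesis by blast
qed

lemma evaluate_cong_WXYZ:
  "p \<simeq>\<^sub>I q \<Longrightarrow> evaluate poincare_gen p = evaluate poincare_gen q"
  using evaluate_ideal_WXYZ[of "p - q"] by (simp add: cong_WXYZ_def evaluate_diff)

lemma part_WXYZ_mult: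
  assumes "p \<in> part_WXYZ m" "q \<in> part_WXYZ n"
  shows "p * q \<in> part_WXYZ (m + n)"
  unfolding part_WXYZ_def
proof (intro CollectI ballI)
  fix e assume "e \<in> Poly_Mapping.keys (p * q)"
  then obtain a b where "a \<in> Poly_Mapping.keys p" "b \<in> Poly_Mapping.keys q" "e = a + b"
    using Poly_Mapping.keys_mult[of p q] by blast
  then show "monomial_deg e = m + n"
    using assms by (simp add: part_WXYZ_def monomial_deg_add)
qed

lemma part_WXYZ_of_int: "of_int c \<in> part_WXYZ 0"
  by (auto simp: part_WXYZ_def monomial_deg_def simp flip: single_of_int)

lemma part_WXYZ_power: "p \<in> part_WXYZ n \<Longrightarrow> p ^ k \<in> part_WXYZ (k * n)"
  using part_WXYZ_of_int[of 1] by (induction k) (auto dest: part_WXYZ_mult)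

lemma part_WXYZ_Var: "Var v \<in> part_WXYZ (indet_deg v)"
  by (simp add: part_WXYZ_def Var_def monomial_deg_single)

lemma standard_monomial_homogeneous:
  assumes "2 * j \<le> n"
  shows "of_int c * standard_monomial n j \<in> part_WXYZ n"
proof -
  note mult = part_WXYZ_mult
  have W: "Var IW ^ a \<in> part_WXYZ a" and Z: "Var IZ ^ a \<in> part_WXYZ (a * 4)" for a
    using part_WXYZ_power[OF part_WXYZ_Var, of IW a] part_WXYZ_power[OF part_WXYZ_Var, of IZ a]
    by simp_all
  from assms have "standard_monomial n j \<in> part_WXYZ n"
  proof (cases rule: standard_index_cases)
    case (W a k)
    show ?thesis
      unfolding W standard_monomial_simps using mult[OF \<open>\<And>a. Var IW ^ a \<in> part_WXYZ a\<close> Z, of a k]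
      by (simp add: ac_simps)
  next
    case (X k)
    show ?thesis
      unfolding X standard_monomial_simps using mult[OF part_WXYZ_Var Z, of IX k]
      by (simp add: ac_simps)
  next
    case (Y a k)
    show ?thesis
      unfolding Y standard_monomial_simps using mult[OF mult[OF W part_WXYZ_Var] Z, of a IY k]
      by (simp add: ac_simps)
  qed
  from mult[OF part_WXYZ_of_int this] show ?thesis by simp
qed

lemma part_WXYZ_sum:
  assumes "\<And>i. i \<in> A \<Longrightarrow> p i \<in> part_WXYZ n"
  shows "(\<Sum>i\<in>A. p i) \<in> part_WXYZ n"
  using assms Poly_Mapping.keys_sum[of p A] by (fastforce simp: part_WXYZ_def)

text \<open>
  The values of the standard monomials of degree \<open>n\<close> form a basis of the symmetric polynomials.
  That standard combinations have symmetric values gives the inclusion from left to right, and that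
  the basis spans gives the other one.
\<close>

lemma evaluate_part_WXYZ: "evaluate poincare_gen ` part_WXYZ n = oriented_poincare_part n"
proof (intro equalityI subsetI)
  fix x assume "x \<in> evaluate poincare_gen ` part_WXYZ n"
  then obtain p where "p \<in> part_WXYZ n" and x: "x = evaluate poincare_gen p" by blast
  then obtain c where c: "p \<simeq>\<^sub>I (\<Sum>j\<le>n div 2. of_int (c j) * standard_monomial n j)"
    using homogeneous_reduces_to_standard by blast
  have "symmetric_coeffs n (\<Sum>j\<le>n div 2. Polynomial.smult (c j) (basis_poly n j))"
    by (intro symmetric_coeffs_sum symmetric_coeffs_smult basis_poly_symmetric) auto
  then show "x \<in> oriented_poincare_part n"
    unfolding x evaluate_cong_WXYZ[OF c] evaluate_standard_combination oriented_poincare_part_eq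
    by blast
next
  fix x assume "x \<in> oriented_poincare_part n"
  then obtain b where "symmetric_coeffs n b" and x: "x = Polynomial.monom b n"
    by (auto simp: oriented_poincare_part_eq)
  then obtain c where "b = (\<Sum>j\<le>n div 2. Polynomial.smult (c j) (basis_poly n j))"
    using basis_poly_spans by blast
  then have "x = evaluate poincare_gen (\<Sum>j\<le>n div 2. of_int (c j) * standard_monomial n j)"
    by (simp add: x evaluate_standard_combination)
  moreover have "(\<Sum>j\<le>n div 2. of_int (c j) * standard_monomial n j) \<in> part_WXYZ n"
    by (intro part_WXYZ_sum standard_monomial_homogeneous) auto
  ultimately show "x \<in> evaluate poincare_gen ` part_WXYZ n" by blast
qed

text \<open>
  By linear independence of the basis, the standard combination to which \<open>p\<close> reduces is trivial.
\<close>

lemma homogeneous_kernel: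
  assumes "p \<in> part_WXYZ n" "evaluate poincare_gen p = 0"
  shows "p \<in> ideal_WXYZ"
proof -
  obtain c where c: "p \<simeq>\<^sub>I (\<Sum>j\<le>n div 2. of_int (c j) * standard_monomial n j)"
    using homogeneous_reduces_to_standard assms(1) by blast
  have "Polynomial.monom (\<Sum>j\<le>n div 2. Polynomial.smult (c j) (basis_poly n j)) n = 0"
    using evaluate_cong_WXYZ[OF c] assms(2) by (simp add: evaluate_standard_combination)
  then have "(\<Sum>j\<le>n div 2. Polynomial.smult (c j) (basis_poly n j)) = 0"
    by (simp only: monom_eq_0_iff)
  then have "c j = 0" if "j \<le> n div 2" for j
    using that by (rule basis_poly_independent)
  then show ?thesis
    using c by (simp add: cong_WXYZ_def)
qed

lemma homogeneous_decomposition: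
  obtains f N where "\<And>n. f n \<in> part_WXYZ n" "p = (\<Sum>n\<le>N. f n)"
proof
  let ?f = "\<lambda>n. \<Sum>m | m \<in> Poly_Mapping.keys p \<and> monomial_deg m = n.
    frag_cmul (Poly_Mapping.lookup p m) (frag_of m)"
  let ?N = "Max (insert 0 (monomial_deg ` Poly_Mapping.keys p))"
  show "?f n \<in> part_WXYZ n" for n
    by (intro part_WXYZ_sum) (auto simp: part_WXYZ_def)
  have "p = (\<Sum>m\<in>Poly_Mapping.keys p. frag_cmul (Poly_Mapping.lookup p m) (frag_of m))"
    using frag_expansion[of p] by (simp add: frag_extend_def)
  also have "\<dots> = (\<Sum>n\<le>?N. ?f n)"
    by (rule sum.group[symmetric]) auto
  finally show "p = (\<Sum>n\<le>?N. ?f n)" .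
qed

lemma oriented_poincare_part_coeff:
  "x \<in> oriented_poincare_part n \<Longrightarrow> k \<noteq> n \<Longrightarrow> Polynomial.coeff x k = 0"
  by (auto simp: oriented_poincare_part_eq)

lemma oriented_poincare_sum_coeff:
  assumes "\<And>n. f n \<in> oriented_poincare_part n" and "finite A"
  shows "Polynomial.coeff (\<Sum>n\<in>A. f n) k = (if k \<in> A then Polynomial.coeff (f k) k else 0)"
proof -
  have "Polynomial.coeff (\<Sum>n\<in>A. f n) k = (\<Sum>n\<in>A. if n = k then Polynomial.coeff (f k) k else 0)"
    unfolding coeff_sum by (intro sum.cong) (auto simp: oriented_poincare_part_coeff[OF assms(1)])
  then show ?thesis using assms(2) by simp
qed

lemma oriented_poincare_part_eqI:
  assumes "x \<in> oriented_poincare_part n" "y \<in> oriented_poincare_part n"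
    and "Polynomial.coeff x n = Polynomial.coeff y n"
  shows "x = y"
  using assms by (auto simp: oriented_poincare_part_eq)

text \<open>
  Homogeneous components of different degrees evaluate to multiples of different powers of \<open>z\<close>, so
  if \<open>p\<close> evaluates to zero then each of its components does, and the homogeneous case applies.
\<close>

lemma kernel_evaluate:
  "a_kernel ring_WXYZ ring_of_type_algebra (evaluate poincare_gen) = ideal_WXYZ"
proof -
  have "p \<in> ideal_WXYZ" if p: "evaluate poincare_gen p = 0" for p
  proof -
    obtain f N where f: "\<And>n. f n \<in> part_WXYZ n" "p = (\<Sum>n\<le>N. f n)"
      using homogeneous_decomposition[of p] by blast
    have part: "evaluate poincare_gen (f n) \<in> oriented_poincare_part n" for n
      using f(1)[of n] evaluate_part_WXYZ[of n] by blast
    have "0 = (\<Sum>n\<le>N. evaluate poincare_gen (f n))"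
      using p f(2) by (simp add: evaluate_sum)
    then have "Polynomial.coeff (evaluate poincare_gen (f n)) n = 0" if "n \<le> N" for n
      using oriented_poincare_sum_coeff[OF part, of "{..N}" n] that by simp
    then have "evaluate poincare_gen (f n) = 0" if "n \<le> N" for n
      using that oriented_poincare_part_coeff[OF part[of n]] by (intro poly_eqI) (metis coeff_0)
    then have "f n \<in> ideal_WXYZ" if "n \<le> N" for n
      using that f(1) homogeneous_kernel by blast
    then show ?thesis unfolding f(2) by (intro ideal_WXYZ_sum) auto
  qed
  then show ?thesis
    using evaluate_ideal_WXYZ by (auto simp: a_kernel_def')
qed

lemma carrier_oriented_poincare_ring:
  "carrier oriented_poincare_ring = range (evaluate poincare_gen)"
proof (intro equalityI subsetI)
  fix x assume "x \<in> carrier oriented_poincare_ring"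
  then obtain f and N :: nat where f: "\<And>n. f n \<in> oriented_poincare_part n" and x: "x = (\<Sum>n\<le>N. f n)"
    by (auto simp: oriented_poincare_ring_def)
  have "\<forall>n. \<exists>p. f n = evaluate poincare_gen p"
    using f unfolding evaluate_part_WXYZ[symmetric] by blast
  then obtain p where "\<And>n. f n = evaluate poincare_gen (p n)" by metis
  then have "x = evaluate poincare_gen (\<Sum>n\<le>N. p n)"
    by (simp add: x evaluate_sum)
  then show "x \<in> range (evaluate poincare_gen)" by blast
next
  fix x assume "x \<in> range (evaluate poincare_gen)"
  then obtain p where x: "x = evaluate poincare_gen p" by blast
  obtain f N where f: "\<And>n. f n \<in> part_WXYZ n" "p = (\<Sum>n\<le>N. f n)"
    using homogeneous_decomposition[of p] by blast
  have "x = (\<Sum>n\<le>N. evaluate poincare_gen (f n))"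
    by (simp add: x f(2) evaluate_sum)
  moreover have "evaluate poincare_gen (f n) \<in> oriented_poincare_part n" for n
    using f(1)[of n] evaluate_part_WXYZ[of n] by blast
  ultimately show "x \<in> carrier oriented_poincare_ring"
    by (auto simp: oriented_poincare_ring_def)
qed

section \<open>Gradings and isomorphisms\<close>

text \<open>
  As an isomorphism is injective and preserves finite sums, \<open>f\<close> decomposes \<open>x\<close> if and only if
  \<open>h \<circ> f\<close> decomposes \<open>h x\<close>; existence and uniqueness of decompositions carry over.
\<close>

lemma graded_ring_transfer:
  fixes R :: "('a, 'm) ring_scheme" and S :: "('b, 'n) ring_scheme"
  assumes "graded_ring R A" "ring S" and iso: "h \<in> ring_iso R S"
  shows "graded_ring S (\<lambda>n. h ` A n)"
proof -
  interpret R: graded_ring R A by fact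
  interpret S: ring S by fact
  have bij: "bij_betw h (carrier R) (carrier S)" and hom: "h \<in> ring_hom R S"
    using iso by (auto simp: ring_iso_def)
  interpret h: ring_hom_ring R S h
    using hom by (intro ring_hom_ringI2 R.ring_axioms S.ring_axioms)
  have inj: "inj_on h (carrier R)" using bij by (rule bij_betw_imp_inj_on)
  have A: "A n \<subseteq> carrier R" for n
    by (rule additive_subgroup.a_subset[OF R.part_subgroup])
  define decomp where "decomp f x \<longleftrightarrow>
    finite {n. f n \<noteq> \<zero>\<^bsub>R\<^esub>} \<and> x = (\<Oplus>\<^bsub>R\<^esub>n\<in>{n. f n \<noteq> \<zero>\<^bsub>R\<^esub>}. f n)" for f :: "nat \<Rightarrow> 'a" and x
  have decomp_iff: "decomp f x \<longleftrightarrow> finite {n. h (f n) \<noteq> \<zero>\<^bsub>S\<^esub>} \<and>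
      h x = (\<Oplus>\<^bsub>S\<^esub>n\<in>{n. h (f n) \<noteq> \<zero>\<^bsub>S\<^esub>}. h (f n))"
    if f: "\<And>n. f n \<in> A n" and x: "x \<in> carrier R" for f x
  proof -
    have fc: "f n \<in> carrier R" for n using f A by blast
    have "h (f n) = \<zero>\<^bsub>S\<^esub> \<longleftrightarrow> f n = \<zero>\<^bsub>R\<^esub>" for n
      using inj_onD[OF inj, of "f n" "\<zero>\<^bsub>R\<^esub>"] fc by auto
    moreover have "h (\<Oplus>\<^bsub>R\<^esub>n\<in>B. f n) = (\<Oplus>\<^bsub>S\<^esub>n\<in>B. h (f n))" for B
      using h.hom_finsum[of f B] fc by (simp add: comp_def)
    moreover have "(\<Oplus>\<^bsub>R\<^esub>n\<in>B. f n) \<in> carrier R" for B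
      using fc by (intro R.finsum_closed) auto
    ultimately show ?thesis
      using inj_on_eq_iff[OF inj] x by (simp add: decomp_def flip: inj_on_eq_iff[OF inj])
  qed
  show ?thesis
  proof (intro graded_ring.intro graded_ring_axioms.intro S.ring_axioms)
    fix n
    have "group_hom (add_monoid R) (add_monoid S) h" by (rule h.a_group_hom)
    then show "additive_subgroup (h ` A n) S"
      using additive_subgroup.a_subgroup[OF R.part_subgroup]
      by (intro additive_subgroupI group_hom.subgroup_img_is_subgroup)
  next
    show "\<one>\<^bsub>S\<^esub> \<in> h ` A 0"
      using R.part_one h.hom_one by force
  next
    fix a b m n assume "a \<in> h ` A m" "b \<in> h ` A n"
    then obtain x y where "x \<in> A m" "y \<in> A n" "a = h x" "b = h y" by blast
    then have "a \<otimes>\<^bsub>S\<^esub> b = h (x \<otimes>\<^bsub>R\<^esub> y)" "x \<otimes>\<^bsub>R\<^esub> y \<in> A (m + n)"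
      using A R.part_mult by (auto simp: subset_iff)
    then show "a \<otimes>\<^bsub>S\<^esub> b \<in> h ` A (m + n)" by blast
  next
    fix y assume "y \<in> carrier S"
    then obtain x where x: "x \<in> carrier R" "y = h x"
      using bij by (auto simp: bij_betw_def)
    obtain f where f: "\<And>n. f n \<in> A n" "decomp f x"
      and unique: "\<And>f'. (\<forall>n. f' n \<in> A n) \<Longrightarrow> decomp f' x \<Longrightarrow> f' = f"
      using R.part_decomp[OF x(1)] unfolding decomp_def by (elim ex1E) blast
    show "\<exists>!g. (\<forall>n. g n \<in> h ` A n) \<and> finite {n. g n \<noteq> \<zero>\<^bsub>S\<^esub>} \<and>
      y = (\<Oplus>\<^bsub>S\<^esub>n\<in>{n. g n \<noteq> \<zero>\<^bsub>S\<^esub>}. g n)"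
    proof (rule ex1I[of _ "\<lambda>n. h (f n)"])
      show "(\<forall>n. h (f n) \<in> h ` A n) \<and> finite {n. h (f n) \<noteq> \<zero>\<^bsub>S\<^esub>} \<and>
        y = (\<Oplus>\<^bsub>S\<^esub>n\<in>{n. h (f n) \<noteq> \<zero>\<^bsub>S\<^esub>}. h (f n))"
        using decomp_iff[of f x] f x by simp
    next
      fix g assume g: "(\<forall>n. g n \<in> h ` A n) \<and> finite {n. g n \<noteq> \<zero>\<^bsub>S\<^esub>} \<and>
        y = (\<Oplus>\<^bsub>S\<^esub>n\<in>{n. g n \<noteq> \<zero>\<^bsub>S\<^esub>}. g n)"
      then have "\<forall>n. \<exists>a. a \<in> A n \<and> g n = h a" by blast
      then obtain f' where f': "\<And>n. f' n \<in> A n" "\<And>n. g n = h (f' n)" by metis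
      then have "decomp f' x" using decomp_iff[of f' x] g x by simp
      then have "f' = f" using unique f' by blast
      then show "g = (\<lambda>n. h (f n))" using f' by auto
    qed
  qed
qed

lemma oriented_poincare_ring_simps [simp]:
  "x \<otimes>\<^bsub>oriented_poincare_ring\<^esub> y = x * y"
  "x \<oplus>\<^bsub>oriented_poincare_ring\<^esub> y = x + y"
  "\<one>\<^bsub>oriented_poincare_ring\<^esub> = 1"
  "\<zero>\<^bsub>oriented_poincare_ring\<^esub> = 0"
  by (simp_all add: oriented_poincare_ring_def ring_of_type_algebra_def)

lemma oriented_poincare_ring_eq:
  "oriented_poincare_ring = ring_of_type_algebra
    \<lparr>carrier := evaluate poincare_gen ` carrier ring_WXYZ\<rparr>"
  using carrier_oriented_poincare_ring by (simp add: oriented_poincare_ring_def)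

lemma ring_oriented_poincare: "ring oriented_poincare_ring"
  unfolding oriented_poincare_ring_eq
  by (rule ring_hom_ring.img_is_ring[OF evaluate_ring_hom])

lemma oriented_poincare_part_subset: "oriented_poincare_part n \<subseteq> carrier oriented_poincare_ring"
  unfolding carrier_oriented_poincare_ring by (simp flip: evaluate_part_WXYZ add: image_mono)

lemma finsum_oriented_poincare:
  assumes "\<And>n. n \<in> A \<Longrightarrow> f n \<in> carrier oriented_poincare_ring"
  shows "(\<Oplus>\<^bsub>oriented_poincare_ring\<^esub>n\<in>A. f n) = (\<Sum>n\<in>A. f n)"
proof -
  interpret ring oriented_poincare_ring by (rule ring_oriented_poincare)
  from assms show ?thesis
    by (induction A rule: infinite_finite_induct) (auto simp: finsum_insert)
qed

text \<open>
  Closure under multiplication is inherited from \<open>\<int>[W,X,Y,Z]\<close> through \<open>evaluate_part_WXYZ\<close>.  The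
  component of degree \<open>n\<close> is determined by the coefficient of \<open>z^n\<close>.
\<close>

lemma graded_ring_oriented_poincare: "graded_ring oriented_poincare_ring oriented_poincare_part"
proof -
  interpret ring oriented_poincare_ring by (rule ring_oriented_poincare)
  have monom: "Polynomial.monom b n \<in> oriented_poincare_part n \<longleftrightarrow> symmetric_coeffs n b" for b n
    by (auto simp: oriented_poincare_part_eq monom_eq_iff')
  have zero: "0 \<in> oriented_poincare_part n" for n
    using monom[of 0 n] by (simp add: symmetric_coeffs_zero)
  have neg: "- x \<in> oriented_poincare_part n" if x: "x \<in> oriented_poincare_part n" for x n
  proof -
    obtain b where b: "x = Polynomial.monom b n" "symmetric_coeffs n b"
      using x by (auto simp: oriented_poincare_part_eq)
    then show ?thesis
      using symmetric_coeffs_diff[OF symmetric_coeffs_zero b(2)] by (simp add: minus_monom monom)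
  qed
  have a_inv: "\<ominus>\<^bsub>oriented_poincare_ring\<^esub> x = - x" if "x \<in> oriented_poincare_part n" for x n
    using that neg[OF that] oriented_poincare_part_subset[of n]
    by (intro minus_equality) auto
  show ?thesis
  proof (intro graded_ring.intro graded_ring_axioms.intro ring_axioms)
    fix n
    show "additive_subgroup (oriented_poincare_part n) oriented_poincare_ring"
    proof (intro additive_subgroupI add.subgroupI)
      show "oriented_poincare_part n \<subseteq> carrier oriented_poincare_ring"
        by (rule oriented_poincare_part_subset)
      show "oriented_poincare_part n \<noteq> {}" using zero by blast
      show "\<ominus>\<^bsub>oriented_poincare_ring\<^esub> x \<in> oriented_poincare_part n"
        if "x \<in> oriented_poincare_part n" for x
        using that by (simp add: a_inv neg)
      show "x \<oplus>\<^bsub>oriented_poincare_ring\<^esub> y \<in> oriented_poincare_part n"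
        if "x \<in> oriented_poincare_part n" "y \<in> oriented_poincare_part n" for x y
        using that symmetric_coeffs_add[of n]
        by (auto simp: oriented_poincare_part_eq add_monom)
    qed
  next
    have "evaluate poincare_gen 1 \<in> evaluate poincare_gen ` part_WXYZ 0"
      using part_WXYZ_of_int[of 1] by simp
    then show "\<one>\<^bsub>oriented_poincare_ring\<^esub> \<in> oriented_poincare_part 0"
      by (simp add: evaluate_part_WXYZ evaluate_one)
  next
    fix x y m n assume "x \<in> oriented_poincare_part m" "y \<in> oriented_poincare_part n"
    then obtain p q where "p \<in> part_WXYZ m" "q \<in> part_WXYZ n"
      "x = evaluate poincare_gen p" "y = evaluate poincare_gen q"
      unfolding evaluate_part_WXYZ[symmetric] by blast
    then show "x \<otimes>\<^bsub>oriented_poincare_ring\<^esub> y \<in> oriented_poincare_part (m + n)"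
      unfolding evaluate_part_WXYZ[symmetric]
      using part_WXYZ_mult[of p m q n]
      by (intro image_eqI[of _ _ "p * q"]) (simp_all add: evaluate_mult)
  next
    fix x assume "x \<in> carrier oriented_poincare_ring"
    then obtain h and N :: nat where h: "\<And>n. h n \<in> oriented_poincare_part n" "x = (\<Sum>n\<le>N. h n)"
      by (auto simp: oriented_poincare_ring_def)
    let ?f = "\<lambda>n. if n \<le> N then h n else 0"
    have sum: "(\<Oplus>\<^bsub>oriented_poincare_ring\<^esub>n\<in>{n. g n \<noteq> 0}. g n) = (\<Sum>n\<in>{n. g n \<noteq> 0}. g n)"
      if "\<And>n. g n \<in> oriented_poincare_part n" for g
      using that oriented_poincare_part_subset by (intro finsum_oriented_poincare) blast
    have f: "?f n \<in> oriented_poincare_part n" for n using h zero by simp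
    have fin: "finite {n. ?f n \<noteq> 0}" by (rule finite_subset[of _ "{..N}"]) auto
    have x: "x = (\<Sum>n\<in>{n. ?f n \<noteq> 0}. ?f n)"
      unfolding h(2) by (rule sum.mono_neutral_cong_right) auto
    have coeff: "Polynomial.coeff (\<Sum>n\<in>{n. g n \<noteq> 0}. g n) n = Polynomial.coeff (g n) n"
      if "\<And>n. g n \<in> oriented_poincare_part n" "finite {n. g n \<noteq> 0}" for g n
      using oriented_poincare_sum_coeff[OF that] by simp
    show "\<exists>!g. (\<forall>n. g n \<in> oriented_poincare_part n) \<and>
      finite {n. g n \<noteq> \<zero>\<^bsub>oriented_poincare_ring\<^esub>} \<and>
      x = (\<Oplus>\<^bsub>oriented_poincare_ring\<^esub>n\<in>{n. g n \<noteq> \<zero>\<^bsub>oriented_poincare_ring\<^esub>}. g n)"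
      unfolding oriented_poincare_ring_simps
    proof (rule ex1I[of _ ?f])
      show "(\<forall>n. ?f n \<in> oriented_poincare_part n) \<and> finite {n. ?f n \<noteq> 0} \<and>
        x = (\<Oplus>\<^bsub>oriented_poincare_ring\<^esub>n\<in>{n. ?f n \<noteq> 0}. ?f n)"
        unfolding sum[OF f] using f fin x by blast
    next
      fix g assume g: "(\<forall>n. g n \<in> oriented_poincare_part n) \<and> finite {n. g n \<noteq> 0} \<and>
        x = (\<Oplus>\<^bsub>oriented_poincare_ring\<^esub>n\<in>{n. g n \<noteq> 0}. g n)"
      then have "x = (\<Sum>n\<in>{n. g n \<noteq> 0}. g n)" using sum[of g] by simp
      then have "Polynomial.coeff (g n) n = Polynomial.coeff (?f n) n" for n
        using coeff[of g n] coeff[OF f fin, of n] g x by argo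
      then show "g = ?f"
        using oriented_poincare_part_eqI g f by blast
    qed
  qed
qed

theorem theorem5:
  shows "graded_ring_isomorphic
    oriented_poincare_ring oriented_poincare_part
    (ring_WXYZ Quot ideal_WXYZ) (quotient_part ring_WXYZ part_WXYZ ideal_WXYZ)"
proof -
  let ?Q = "ring_WXYZ Quot ideal_WXYZ"
  define h where "h C = the_elem (evaluate poincare_gen ` C)" for C
  note hom = evaluate_ring_hom[of poincare_gen]
  have h: "h \<in> ring_iso ?Q oriented_poincare_ring"
    using ring_hom_ring.FactRing_iso_set_aux[OF hom]
    unfolding h_def[abs_def] kernel_evaluate oriented_poincare_ring_eq .
  have ringQ: "ring ?Q" by (rule ideal.quotient_is_ring[OF ideal_WXYZ_ideal])
  \<comment> \<open>The isomorphism theorem gives the map out of the quotient; the inverse goes the way needed.\<close>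
  let ?k = "inv_into (carrier ?Q) h"
  have k: "?k \<in> ring_iso oriented_poincare_ring ?Q"
    using h ringQ by (simp add: ring_iso_set_sym)
  have inj: "inj_on h (carrier ?Q)"
    using h by (auto simp: ring_iso_def bij_betw_def)
  have image: "?k ` oriented_poincare_part n = quotient_part ring_WXYZ part_WXYZ ideal_WXYZ n" for n
  proof -
    let ?coset = "\<lambda>p. ideal_WXYZ +>\<^bsub>ring_WXYZ\<^esub> p"
    have coset: "?coset p \<in> carrier ?Q" for p
      by (auto simp: FactRing_def A_RCOSETS_def')
    have "h (?coset p) = evaluate poincare_gen p" for p
      using ring_hom_ring.the_elem_simp[OF hom, of p] by (simp add: h_def kernel_evaluate)
    then have "?k (evaluate poincare_gen p) = ?coset p" for p
      using inv_into_f_f[OF inj coset, of p] by simp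
    then show ?thesis
      unfolding quotient_part_def evaluate_part_WXYZ[symmetric] image_image by simp
  qed
  have "graded_ring ?Q (quotient_part ring_WXYZ part_WXYZ ideal_WXYZ)"
    using graded_ring_transfer[OF graded_ring_oriented_poincare ringQ k] by (simp add: image)
  with graded_ring_oriented_poincare k image show ?thesis
    unfolding graded_ring_isomorphic_def by blast
qed

end
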